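(* Let $m\ge n\ge1$ be integers and let $\pmb s=(s_{ij})\in W_{(m,n)}$ be a tableau of shape $(m,n)$ with first row $(s_{11},\dots,s_{1m})$ and second row $(s_{21},\dots,s_{2n})$. Assume $\Re(s_{1m})>1$, $\Re(s_{2n})>1$ and (if $n\ge2$) $\Re(s_{1(n-1)})>1$. Then $$\sum_{diag}\zeta_{(m,n)}(\pmb s)=\sum_{diag}\begin{vmatrix}\zeta^\star(s_{11},\dots,s_{1m})&\zeta^\star(s_{21},\dots,s_{2n},s_{1n},\dots,s_{1m})\\ \zeta^\star(s_{11},\dots,s_{1(n-1)})&\zeta^\star(s_{21},\dots,s_{2n})\end{vmatrix},$$ where $\sum_{diag}$ means the sum of the $2^{n-1}$ expressions obtained by, independently for each $j\in\{1,\dots,n-1\}$, either leaving the variables unchanged or interchanging $s_{1j}$ and $s_{2(j+1)}$.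
   Context: For a partition $\lambda$ with diagram $D(\lambda)=\{(i,j):1\le j\le\lambda_i\}$, $T(\lambda,X)$ is the set of fillings of $D(\lambda)$ by elements of $X$, and $SSYT(\lambda)$ is the set of fillings $(m_{ij})$ by positive integers weakly increasing along rows and strictly increasing down columns. The Schur multiple zeta function is $\zeta_\lambda(\pmb s)=\sum_{(m_{ij})\in SSYT(\lambda)}\prod_{(i,j)\in D(\lambda)}m_{ij}^{-s_{ij}}$ for $\pmb s=(s_{ij})\in T(\lambda,\mathbb C)$. $W_\lambda$ is the set of $\pmb s\in T(\lambda,\mathbb C)$ with $\Re(s_{ij})\ge1$ for all boxes and $\Re(s_{ij})>1$ for every corner $(i,j)$ (a box with $(i+1,j),(i,j+1)\notin D(\lambda)$). The multiple zeta-star function is $$\zeta^\star(s_1,\dots,s_r)=\sum_{1\le n_1\le\cdots\le n_r}\frac1{n_1^{s_1}\cdots n_r^{s_r}},$$ and $\zeta^\star$ of the empty sequence is $1$. *)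

theory Defs
  imports "HOL-Analysis.Analysis"
begin

text \<open>
  A partition is the list of its parts in weakly decreasing order. Boxes are pairs
  (row, column), both counted from 1.
\<close>

definition diagram :: "nat list \<Rightarrow> (nat \<times> nat) set" where
  "diagram \<nu> = {(i, j). 1 \<le> i \<and> i \<le> length \<nu> \<and> 1 \<le> j \<and> j \<le> \<nu> ! (i - 1)}"

text \<open>
  Fillings are extensional functions (\<open>undefined\<close> outside the diagram), so that distinct
  elements are distinct fillings and sums over tableaux count each tableau once.
\<close>

definition fillings :: "nat list \<Rightarrow> 'a set \<Rightarrow> (nat \<times> nat \<Rightarrow> 'a) set" where
  "fillings \<nu> X = (diagram \<nu> \<rightarrow>\<^sub>E X)"

definition SSYT :: "nat list \<Rightarrow> (nat \<times> nat \<Rightarrow> nat) set" where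
  "SSYT \<nu> = {M \<in> fillings \<nu> {1..}.
     (\<forall>i j. (i, j) \<in> diagram \<nu> \<and> (i, j + 1) \<in> diagram \<nu> \<longrightarrow> M (i, j) \<le> M (i, j + 1)) \<and>
     (\<forall>i j. (i, j) \<in> diagram \<nu> \<and> (i + 1, j) \<in> diagram \<nu> \<longrightarrow> M (i, j) < M (i + 1, j))}"

text \<open>
  Both series below converge absolutely for the arguments of interest, so they are unordered
  sums; \<^const>\<open>infsum\<close> has the value 0 where the family is not summable.
\<close>

definition schur_zeta :: "nat list \<Rightarrow> (nat \<times> nat \<Rightarrow> complex) \<Rightarrow> complex" where
  "schur_zeta \<nu> s = (\<Sum>\<^sub>\<infinity>M\<in>SSYT \<nu>. \<Prod>b\<in>diagram \<nu>. of_nat (M b) powr (- s b))"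

definition zeta_star :: "complex list \<Rightarrow> complex" where
  "zeta_star ss =
     (\<Sum>\<^sub>\<infinity>ns\<in>{ns :: nat list. length ns = length ss \<and> sorted ns \<and> (\<forall>n\<in>set ns. 1 \<le> n)}.
        1 / (\<Prod>k<length ss. of_nat (ns ! k) powr (ss ! k)))"

definition is_corner :: "nat list \<Rightarrow> nat \<times> nat \<Rightarrow> bool" where
  "is_corner \<nu> = (\<lambda>(i, j). (i, j) \<in> diagram \<nu> \<and>
     (i + 1, j) \<notin> diagram \<nu> \<and> (i, j + 1) \<notin> diagram \<nu>)"

definition W :: "nat list \<Rightarrow> (nat \<times> nat \<Rightarrow> complex) set" where
  "W \<nu> = {s \<in> fillings \<nu> UNIV.
     (\<forall>b\<in>diagram \<nu>. Re (s b) \<ge> 1) \<and> (\<forall>b. is_corner \<nu> b \<longrightarrow> Re (s b) > 1)}"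

definition row_segment :: "(nat \<times> nat \<Rightarrow> 'a) \<Rightarrow> nat \<Rightarrow> nat \<Rightarrow> nat \<Rightarrow> 'a list" where
  "row_segment s i a b = map (\<lambda>j. s (i, j)) [a..<Suc b]"

text \<open>
  For a set \<open>J\<close> of positive integers: interchange the entries of the boxes \<open>(1, j)\<close> and
  \<open>(2, j + 1)\<close> for every \<open>j \<in> J\<close>.
\<close>

definition diag_swap :: "nat set \<Rightarrow> (nat \<times> nat \<Rightarrow> 'a) \<Rightarrow> nat \<times> nat \<Rightarrow> 'a" where
  "diag_swap J s = (\<lambda>(i, j).
     if i = 1 \<and> j \<in> J then s (2, j + 1)
     else if i = 2 \<and> j - 1 \<in> J then s (1, j - 1)
     else s (i, j))"

text \<open>The index \<open>n\<close> is the length of the second row of the shape.\<close>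

definition sum_diag ::
  "nat \<Rightarrow> ((nat \<times> nat \<Rightarrow> 'a) \<Rightarrow> 'b::comm_monoid_add) \<Rightarrow> (nat \<times> nat \<Rightarrow> 'a) \<Rightarrow> 'b" where
  "sum_diag n F s = (\<Sum>J\<in>Pow {1..n - 1}. F (diag_swap J s))"

end

theory Submission imports Defs begin

text \<open>
  The argument is the Lindstroem-Gessel-Viennot sign reversal, with one twist: exchanging tails
  does not preserve the weights, and the sum over diagonal interchanges repairs this.

  A tableau of shape \<open>(m, n)\<close> is a pair of weakly increasing lists \<open>a\<close>, \<open>b\<close> of lengths \<open>m\<close>, \<open>n\<close>
  with \<open>a\<^sub>k < b\<^sub>k\<close> for all \<open>k\<close>. Dropping the last condition gives the product of the diagonal entries
  of the determinant, so the identity says that the pairs violating it contribute the product of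
  the two off-diagonal entries, which is a sum over pairs \<open>(d, c)\<close> of weakly increasing lists of
  lengths \<open>n - 1\<close> and \<open>m + 1\<close>. Cutting both lists of a violating pair at the first \<open>k\<close> with
  \<open>b\<^sub>k \<le> a\<^sub>k\<close> and exchanging the tails,
  \<open>d = a\<^sub>1 \<dots> a\<^sub>k\<^sub>-\<^sub>1 b\<^sub>k\<^sub>+\<^sub>1 \<dots> b\<^sub>n\<close> and \<open>c = b\<^sub>1 \<dots> b\<^sub>k a\<^sub>k \<dots> a\<^sub>m\<close>,
  is a bijection onto all such pairs (\<open>bij_betw_tail_swap\<close>). The exponent lists of the
  off-diagonal entries come from the rows of the tableau of variables by the same exchange at the
  fixed place \<open>k = n\<close>; the discrepancy between the two exchanges is exactly the interchange of
  \<open>s\<^sub>1\<^sub>j\<close> and \<open>s\<^sub>2\<^sub>,\<^sub>j\<^sub>+\<^sub>1\<close> for \<open>k \<le> j \<le> n - 1\<close> (\<open>exchange_exchange_row_pair\<close>), and the sum over all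
  interchanges is invariant under that one (\<open>sum_diag_diag_swap\<close>). Hence the two sums agree term
  by term. Splitting and rearranging is legitimate because all series converge absolutely
  (\<open>abs_summable_monomial\<close>).
\<close>

section \<open>Power products over weakly increasing lists\<close>

definition monomial :: "complex list \<Rightarrow> nat list \<Rightarrow> complex" where
  "monomial ss ns = prod_list (map2 (\<lambda>s n. of_nat n powr - s) ss ns)"

definition increasing_lists :: "nat \<Rightarrow> nat list set" where
  "increasing_lists r = {ns. length ns = r \<and> sorted ns \<and> (\<forall>n\<in>set ns. 1 \<le> n)}"

lemma monomial_append:
  "length ss = length ns \<Longrightarrow>
    monomial (ss @ ss') (ns @ ns') = monomial ss ns * monomial ss' ns'"
  by (simp add: monomial_def)

lemma monomial_eq_prod:
  assumes "length ns = length ss"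
  shows "monomial ss ns = (\<Prod>k<length ss. of_nat (ns ! k) powr - (ss ! k))"
  using assms by (simp add: monomial_def prod.list_conv_set_nth atLeast0LessThan)

lemma zeta_star_eq_infsum_monomial:
  "zeta_star ss = infsum (monomial ss) (increasing_lists (length ss))"
  unfolding zeta_star_def increasing_lists_def
  by (intro infsum_cong)
    (auto simp: monomial_eq_prod powr_minus_divide prod_dividef)

section \<open>Absolute convergence\<close>

text \<open>
  By Fubini the series over all lists of length \<open>r\<close> is the \<open>r\<close>-th power of the series over \<open>A\<close>.
\<close>

lemma summable_on_prod_list:
  fixes f :: "'a \<Rightarrow> real"
  assumes f: "f summable_on A" and nonneg: "\<And>x. x \<in> A \<Longrightarrow> 0 \<le> f x"
  shows "(\<lambda>xs. prod_list (map f xs)) summable_on {xs. length xs = r \<and> set xs \<subseteq> A}"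
proof (induction r)
  case 0
  have "{xs. length xs = 0 \<and> set xs \<subseteq> A} = {[]}" by auto
  then show ?case by simp
next
  case (Suc r)
  let ?L = "{xs. length xs = r \<and> set xs \<subseteq> A}"
  have "(\<lambda>(x, xs). f x * prod_list (map f xs)) summable_on (A \<times> ?L)"
  proof (rule summable_on_SigmaI)
    fix x
    show "((\<lambda>xs. case (x, xs) of (x, xs) \<Rightarrow> f x * prod_list (map f xs)) has_sum
        f x * infsum (\<lambda>xs. prod_list (map f xs)) ?L) ?L"
      using has_sum_cmult_right[OF has_sum_infsum[OF Suc.IH], of "f x"] by simp
  next
    show "(\<lambda>x. f x * infsum (\<lambda>xs. prod_list (map f xs)) ?L) summable_on A"
      using summable_on_cmult_left[OF f] by simp
  next
    fix x xs assume "x \<in> A" "xs \<in> ?L"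
    moreover from this have "0 \<le> prod_list (map f xs)"
      by (intro prod_list_nonneg) (use nonneg in fastforce)
    ultimately show "0 \<le> (case (x, xs) of (x, xs) \<Rightarrow> f x * prod_list (map f xs))"
      using nonneg by simp
  qed
  also have "(\<lambda>(x, xs). f x * prod_list (map f xs)) =
      (\<lambda>z. prod_list (map f (case z of (x, xs) \<Rightarrow> x # xs)))"
    by auto
  finally have "(\<lambda>z. prod_list (map f (case z of (x, xs) \<Rightarrow> x # xs))) summable_on (A \<times> ?L)" .
  moreover have "bij_betw (\<lambda>(x, xs). x # xs) (A \<times> ?L) {xs. length xs = Suc r \<and> set xs \<subseteq> A}"
    by (rule bij_betw_byWitness[where f' = "\<lambda>xs. (hd xs, tl xs)"])
      (auto simp: length_Suc_conv)
  ultimately show ?case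
    using summable_on_reindex_bij_betw[of "\<lambda>(x, xs). x # xs" _ _ "\<lambda>xs. prod_list (map f xs)"]
    by blast
qed

lemma infsum_finite_sum:
  fixes f :: "'i \<Rightarrow> 'a \<Rightarrow> 'b :: {topological_comm_monoid_add, t2_space}"
  assumes "finite I" "\<And>i. i \<in> I \<Longrightarrow> f i summable_on A"
  shows "infsum (\<lambda>x. \<Sum>i\<in>I. f i x) A = (\<Sum>i\<in>I. infsum (f i) A)"
proof (rule infsumI)
  show "((\<lambda>x. \<Sum>i\<in>I. f i x) has_sum (\<Sum>i\<in>I. infsum (f i) A)) A"
    using assms by (induction I rule: finite_induct) (auto intro!: has_sum_add has_sum_infsum)
qed

definition convergent_exponents :: "complex list \<Rightarrow> bool" where
  "convergent_exponents ss \<longleftrightarrow>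
     (\<forall>s\<in>set ss. 1 \<le> Re s) \<and> (ss \<noteq> [] \<longrightarrow> 1 < Re (last ss))"

text \<open>
  The excess \<open>\<delta>\<close> of the last exponent over 1 can be shared among all entries: in an increasing
  list the last entry \<open>n\<^sub>r\<close> is the largest, so \<open>n\<^sub>r powr - \<delta>\<close> is at most the product of the
  \<open>n\<^sub>k powr - (\<delta> / r)\<close>. This bounds the term by a product of terms of the convergent
  single-variable series with exponent \<open>1 + \<delta> / r\<close>, which may be summed over all lists.
\<close>

lemma abs_summable_monomial:
  assumes "convergent_exponents ss"
  shows "(\<lambda>ns. norm (monomial ss ns)) summable_on increasing_lists (length ss)"
proof (cases "ss = []")
  case True
  have "increasing_lists 0 = {[]}" by (auto simp: increasing_lists_def)
  with True show ?thesis by simp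
next
  case False
  define r where "r = length ss"
  define \<delta> where "\<delta> = Re (last ss) - 1"
  define f where "f = (\<lambda>n::nat. real n powr - (1 + \<delta> / r))"
  have r: "r > 0" using False by (simp add: r_def)
  have \<delta>: "\<delta> > 0" using assms False by (simp add: convergent_exponents_def \<delta>_def)
  have "summable f"
    unfolding f_def using r \<delta> by (simp add: summable_real_powr_iff)
  then have "f summable_on UNIV"
    by (intro norm_summable_imp_summable_on) (simp add: f_def)
  then have "f summable_on {1..}" by (rule summable_on_subset_banach) simp
  then have *: "(\<lambda>ns. prod_list (map f ns)) summable_on {ns. length ns = r \<and> set ns \<subseteq> {1..}}"
    by (rule summable_on_prod_list) (simp add: f_def)
  have **: "(\<lambda>ns. prod_list (map f ns)) summable_on increasing_lists r"
    by (rule summable_on_subset_banach[OF *]) (auto simp: increasing_lists_def)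
  show ?thesis unfolding r_def[symmetric]
  proof (rule Infinite_Sum.abs_summable_on_comparison_test'[OF **])
    fix ns assume ns: "ns \<in> increasing_lists r"
    then have len: "length ns = r" and sorted: "sorted ns" and pos: "\<And>k. k < r \<Longrightarrow> 1 \<le> ns ! k"
      by (auto simp: increasing_lists_def)
    have "norm (monomial ss ns) = (\<Prod>k<r. real (ns ! k) powr - Re (ss ! k))"
    proof -
      have "norm (of_nat k powr - s :: complex) = real k powr - Re s" if "1 \<le> k" for k s
        using that norm_powr_real[of "of_nat k" "- s"] by (simp add: powr_def)
      then show ?thesis
        using len pos by (simp add: monomial_eq_prod r_def prod_norm[symmetric])
    qed
    also have "\<dots> \<le> (\<Prod>k<r. real (ns ! k) powr - (if k = r - 1 then 1 + \<delta> else 1))"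
    proof (intro prod_mono conjI)
      fix k assume k: "k \<in> {..<r}"
      have "(if k = r - 1 then 1 + \<delta> else 1) \<le> Re (ss ! k)"
        using assms k False by (auto simp: convergent_exponents_def \<delta>_def r_def last_conv_nth)
      then show "real (ns ! k) powr - Re (ss ! k) \<le>
          real (ns ! k) powr - (if k = r - 1 then 1 + \<delta> else 1)"
        using pos[of k] k by (intro powr_mono) auto
    qed simp
    also have "\<dots> = (\<Prod>k<r. real (ns ! k) powr - 1 *
        (if k = r - 1 then real (ns ! k) powr - \<delta> else 1))"
      using powr_add[of _ "- 1" "- \<delta>"] by (intro prod.cong) auto
    also have "\<dots> = (\<Prod>k<r. real (ns ! k) powr - 1) * real (ns ! (r - 1)) powr - \<delta>"
      unfolding prod.distrib using r by (simp add: prod.delta)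
    also have "real (ns ! (r - 1)) powr - \<delta> = (\<Prod>k<r. real (ns ! (r - 1)) powr - (\<delta> / r))"
      using r pos[of "r - 1"] by (simp add: powr_power)
    also have "(\<Prod>k<r. real (ns ! k) powr - 1) * \<dots> \<le>
        (\<Prod>k<r. real (ns ! k) powr - 1) * (\<Prod>k<r. real (ns ! k) powr - (\<delta> / r))"
    proof (intro mult_left_mono prod_mono conjI prod_nonneg)
      fix k assume k: "k \<in> {..<r}"
      have "ns ! k \<le> ns ! (r - 1)"
        using sorted k len by (intro sorted_nth_mono) auto
      then show "real (ns ! (r - 1)) powr - (\<delta> / r) \<le> real (ns ! k) powr - (\<delta> / r)"
        using pos[of k] k \<delta> r by (intro powr_mono2') auto
    qed auto
    also have "\<dots> = (\<Prod>k<r. f (ns ! k))"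
      unfolding prod.distrib[symmetric] f_def
      using powr_add[of _ "- 1" "- (\<delta> / r)"] by (intro prod.cong) auto
    also have "\<dots> = prod_list (map f ns)"
      using len by (simp add: prod.list_conv_set_nth atLeast0LessThan)
    finally show "norm (monomial ss ns) \<le> prod_list (map f ns)" .
  qed
qed

definition pair_monomial ::
    "complex list \<times> complex list \<Rightarrow> nat list \<times> nat list \<Rightarrow> complex" where
  "pair_monomial = (\<lambda>(ss, ss') (ns, ns'). monomial ss ns * monomial ss' ns')"

lemma pair_monomial_sums:
  assumes "convergent_exponents ss" "convergent_exponents ss'"
  defines "X \<equiv> increasing_lists (length ss) \<times> increasing_lists (length ss')"
  shows "pair_monomial (ss, ss') summable_on X"
    and "infsum (pair_monomial (ss, ss')) X = zeta_star ss * zeta_star ss'"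
proof -
  let ?A = "increasing_lists (length ss)" and ?B = "increasing_lists (length ss')"
  have A: "(\<lambda>ns. norm (monomial ss ns)) summable_on ?A"
    and B: "(\<lambda>ns. norm (monomial ss' ns)) summable_on ?B"
    using assms abs_summable_monomial by auto
  have "(\<lambda>z. norm (pair_monomial (ss, ss') z)) summable_on X"
    unfolding X_def
  proof (subst Infinite_Sum.abs_summable_on_Sigma_iff, intro conjI ballI)
    fix ns
    show "(\<lambda>ns'. norm (pair_monomial (ss, ss') (ns, ns'))) summable_on ?B"
      using summable_on_cmult_right[OF B] by (simp add: pair_monomial_def norm_mult)
  next
    have "(\<lambda>ns. norm (monomial ss ns) * (\<Sum>\<^sub>\<infinity>ns'\<in>?B. norm (monomial ss' ns'))) summable_on ?A"
      by (rule summable_on_cmult_left[OF A])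
    then show "(\<lambda>ns. norm (\<Sum>\<^sub>\<infinity>ns'\<in>?B. norm (pair_monomial (ss, ss') (ns, ns')))) summable_on ?A"
      by (simp add: pair_monomial_def norm_mult infsum_cmult_right' infsum_nonneg abs_mult)
  qed
  then show sum: "pair_monomial (ss, ss') summable_on X"
    by (rule abs_summable_summable)
  have "infsum (pair_monomial (ss, ss')) X =
      (\<Sum>\<^sub>\<infinity>ns\<in>?A. \<Sum>\<^sub>\<infinity>ns'\<in>?B. pair_monomial (ss, ss') (ns, ns'))"
    using sum unfolding X_def by (rule infsum_Sigma_banach[symmetric])
  then show "infsum (pair_monomial (ss, ss')) X = zeta_star ss * zeta_star ss'"
    by (simp add: pair_monomial_def infsum_cmult_right' infsum_cmult_left'
        zeta_star_eq_infsum_monomial)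
qed

section \<open>Exchanging tails\<close>

text \<open>
  The cut is uneven: the first list keeps \<open>p\<close> entries and the second \<open>p + 1\<close>. So lengths
  \<open>(l, r)\<close> become \<open>(r - 1, l + 1)\<close>, and the same formula undoes the exchange.
\<close>

definition exchange :: "nat \<Rightarrow> 'a list \<times> 'a list \<Rightarrow> 'a list \<times> 'a list" where
  "exchange p = (\<lambda>(x, y). (take p x @ drop (Suc p) y, take (Suc p) y @ drop p x))"

lemma exchange_exchange:
  assumes "p \<le> length x" "p < length y"
  shows "exchange p (exchange p (x, y)) = (x, y)"
  using assms by (simp add: exchange_def)

lemma pair_monomial_exchange:
  assumes "length x = length a" "length y = length b"
  shows "pair_monomial (exchange p (x, y)) (exchange p (a, b)) = pair_monomial (x, y) (a, b)"
proof -
  have "monomial x a = monomial (take p x) (take p a) * monomial (drop p x) (drop p a)"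
    using assms by (subst monomial_append[symmetric]) auto
  moreover have "monomial y b =
      monomial (take (Suc p) y) (take (Suc p) b) * monomial (drop (Suc p) y) (drop (Suc p) b)"
    using assms by (subst monomial_append[symmetric]) auto
  ultimately show ?thesis
    using assms by (simp add: exchange_def pair_monomial_def monomial_append)
qed

text \<open>
  The alternative \<open>k = n - 1\<close> provides a cut for pairs of lengths \<open>n - 1\<close> and \<open>m + 1\<close> that do not
  cross along the first list: there the whole first list stays and the second is cut after \<open>n\<close> entries. A pair
  with a crossing among the first \<open>n\<close> places is cut at the first one, so one definition serves
  both directions of the bijection.
\<close>

definition crossing :: "nat \<Rightarrow> nat list \<times> nat list \<Rightarrow> nat" where
  "crossing n = (\<lambda>(x, y). LEAST k. k = n - 1 \<or> y ! k \<le> x ! k)"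

lemma crossing_eqI:
  assumes "p \<le> n - 1" "\<And>k. k < p \<Longrightarrow> x ! k < y ! k" "p < n - 1 \<Longrightarrow> y ! p \<le> x ! p"
  shows "crossing n (x, y) = p"
  unfolding crossing_def split
proof (rule Least_equality)
  show "p = n - 1 \<or> y ! p \<le> x ! p" using assms by linarith
next
  fix k assume "k = n - 1 \<or> y ! k \<le> x ! k"
  then show "p \<le> k" using assms(1) assms(2)[of k] by linarith
qed

lemma crossing_props:
  fixes n x y
  defines "p \<equiv> crossing n (x, y)"
  shows crossing_le: "p \<le> n - 1"
    and less_before_crossing: "\<And>k. k < p \<Longrightarrow> x ! k < y ! k"
    and at_crossing: "p = n - 1 \<or> y ! p \<le> x ! p"
proof -
  show "p \<le> n - 1" unfolding p_def crossing_def split by (rule Least_le) simp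
  show "x ! k < y ! k" if "k < p" for k
    using not_less_Least[OF that[unfolded p_def crossing_def split]] by simp
  show "p = n - 1 \<or> y ! p \<le> x ! p"
    unfolding p_def crossing_def split by (rule LeastI[where k = "n - 1"]) simp
qed

definition tail_swap :: "nat \<Rightarrow> nat list \<times> nat list \<Rightarrow> nat list \<times> nat list" where
  "tail_swap n z = exchange (crossing n z) z"

lemma sorted_take_drop:
  fixes x y :: "nat list"
  assumes "sorted x" "sorted y"
    and "\<And>i j. i < p \<Longrightarrow> i < length x \<Longrightarrow> q \<le> j \<Longrightarrow> j < length y \<Longrightarrow> x ! i \<le> y ! j"
  shows "sorted (take p x @ drop q y)"
proof -
  have "u \<le> v" if "u \<in> set (take p x)" "v \<in> set (drop q y)" for u v
  proof -
    obtain i where "i < p" "i < length x" "u = x ! i"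
      using \<open>u \<in> set (take p x)\<close> by (auto simp: in_set_conv_nth)
    moreover obtain j where "j < length y - q" "v = y ! (q + j)"
      using \<open>v \<in> set (drop q y)\<close> by (auto simp: in_set_conv_nth)
    ultimately show ?thesis using assms(3)[of i "q + j"] by simp
  qed
  then show ?thesis using assms by (simp add: sorted_append sorted_wrt_take sorted_wrt_drop)
qed

text \<open>
  Stated so as to cover both kinds of pairs, lengths \<open>(m, n)\<close> with a crossing and lengths
  \<open>(n - 1, m + 1)\<close>. Write \<open>p\<close> for the cut. The new lists are increasing because
  \<open>x\<^sub>i < y\<^sub>i \<le> y\<^sub>j\<close> for \<open>i < p < j\<close> and \<open>y\<^sub>p \<le> x\<^sub>p\<close> whenever \<open>x\<close> has a place \<open>p\<close>.
  The cut of the new pair is again \<open>p\<close>, because the entries before it are untouched and at \<open>p\<close> the comparison becomes \<open>y\<^sub>p \<le> y\<^sub>p\<^sub>+\<^sub>1\<close>; therefore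
  swapping twice is the identity.
\<close>

lemma tail_swap_props:
  assumes x: "x \<in> increasing_lists l" and y: "y \<in> increasing_lists r"
    and n: "n \<ge> 1" "n - 1 \<le> l" "n \<le> r"
    and cross: "n \<le> l \<Longrightarrow> \<exists>k<n. y ! k \<le> x ! k"
  shows tail_swap_in: "tail_swap n (x, y) \<in> increasing_lists (r - 1) \<times> increasing_lists (Suc l)"
    and crossing_tail_swap: "crossing n (tail_swap n (x, y)) = crossing n (x, y)"
    and tail_swap_tail_swap: "tail_swap n (tail_swap n (x, y)) = (x, y)"
    and tail_swap_crosses: "n < r \<Longrightarrow>
      \<exists>k<n. snd (tail_swap n (x, y)) ! k \<le> fst (tail_swap n (x, y)) ! k"
proof -
  define p where "p = crossing n (x, y)"
  have len: "length x = l" "length y = r" and sorted: "sorted x" "sorted y"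
    and pos: "\<forall>k\<in>set x. 1 \<le> k" "\<forall>k\<in>set y. 1 \<le> k"
    using x y by (auto simp: increasing_lists_def)
  have p: "p \<le> n - 1" using crossing_le p_def by simp
  have before: "x ! k < y ! k" if "k < p" for k
    using less_before_crossing that p_def by simp
  have at: "y ! p \<le> x ! p" if "p < l"
  proof (cases "p = n - 1")
    case True
    \<comment> \<open>The cut may have been forced by the alternative in \<open>crossing\<close>, but the first list reaches
      place \<open>n - 1\<close>, so some crossing exists and it cannot lie before \<open>p\<close>.\<close>
    then have "n \<le> l" using that n by linarith
    then obtain k where "k < n" "y ! k \<le> x ! k" using cross by auto
    moreover from this have "\<not> k < p" using before by fastforce
    ultimately show ?thesis using True
      by (metis Suc_pred' less_Suc_eq linorder_neqE_nat n(1) less_le_trans zero_less_one)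
  next
    case False
    then show ?thesis using at_crossing p_def by blast
  qed
  define x' where "x' = take p x @ drop (Suc p) y"
  define y' where "y' = take (Suc p) y @ drop p x"
  have swap: "tail_swap n (x, y) = (x', y')"
    by (simp add: tail_swap_def exchange_def p_def x'_def y'_def)
  have "sorted x'"
    unfolding x'_def
  proof (rule sorted_take_drop[OF sorted])
    fix i j assume "i < p" "Suc p \<le> j" "j < length y"
    then show "x ! i \<le> y ! j"
      using before[of i] sorted_nth_mono[OF sorted(2), of i j] by simp
  qed
  moreover have "sorted y'"
    unfolding y'_def
  proof (rule sorted_take_drop[OF sorted(2,1)])
    fix i j assume "i < Suc p" "i < length y" "p \<le> j" "j < length x"
    moreover have "p < r" using p n by linarith
    ultimately show "y ! i \<le> x ! j"
      using at sorted_nth_mono[OF sorted(2), of i p] sorted_nth_mono[OF sorted(1), of p j] len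
      by simp
  qed
  moreover have "length x' = r - 1" "length y' = Suc l"
    using len p n by (auto simp: x'_def y'_def)
  moreover have "\<forall>k\<in>set x'. 1 \<le> k" "\<forall>k\<in>set y'. 1 \<le> k"
    using pos unfolding x'_def y'_def by (auto dest!: in_set_takeD in_set_dropD)
  ultimately show "tail_swap n (x, y) \<in> increasing_lists (r - 1) \<times> increasing_lists (Suc l)"
    by (simp add: swap increasing_lists_def)
  have at': "y' ! p \<le> x' ! p" if "Suc p < r"
    using that sorted_nth_mono[OF sorted(2), of p "Suc p"] len p n
    by (simp add: x'_def y'_def nth_append)
  have "crossing n (x', y') = p"
  proof (rule crossing_eqI)
    show "p \<le> n - 1" by (rule p)
    show "x' ! k < y' ! k" if "k < p" for k
      using that before[OF that] len p n by (simp add: x'_def y'_def nth_append)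
    show "y' ! p \<le> x' ! p" if "p < n - 1"
      using at' that n by simp
  qed
  then show cr: "crossing n (tail_swap n (x, y)) = crossing n (x, y)"
    by (simp add: swap p_def)
  have "tail_swap n (tail_swap n (x, y)) = exchange p (exchange p (x, y))"
    unfolding tail_swap_def[of n "tail_swap n (x, y)"] cr
    by (simp add: tail_swap_def p_def)
  also have "\<dots> = (x, y)"
    using len p n by (intro exchange_exchange) auto
  finally show "tail_swap n (tail_swap n (x, y)) = (x, y)" .
  show "\<exists>k<n. snd (tail_swap n (x, y)) ! k \<le> fst (tail_swap n (x, y)) ! k" if "n < r"
    unfolding swap using at' p n that by (intro exI[of _ p]) auto
qed

definition crossing_pairs :: "nat \<Rightarrow> nat \<Rightarrow> (nat list \<times> nat list) set" where
  "crossing_pairs m n = {(a, b) \<in> increasing_lists m \<times> increasing_lists n. \<exists>k<n. b ! k \<le> a ! k}"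

definition noncrossing_pairs :: "nat \<Rightarrow> nat \<Rightarrow> (nat list \<times> nat list) set" where
  "noncrossing_pairs m n = {(a, b) \<in> increasing_lists m \<times> increasing_lists n. \<forall>k<n. a ! k < b ! k}"

lemma bij_betw_tail_swap:
  assumes "1 \<le> n" "n \<le> m"
  shows "bij_betw (tail_swap n) (crossing_pairs m n)
    (increasing_lists (n - 1) \<times> increasing_lists (Suc m))"
proof (rule bij_betw_byWitness[where f' = "tail_swap n"])
  let ?C = "increasing_lists (n - 1) \<times> increasing_lists (Suc m)"
  show "\<forall>z\<in>crossing_pairs m n. tail_swap n (tail_swap n z) = z"
    using assms by (auto simp: crossing_pairs_def intro!: tail_swap_tail_swap)
  show "\<forall>z\<in>?C. tail_swap n (tail_swap n z) = z"
    using assms by (auto intro!: tail_swap_tail_swap)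
  show "tail_swap n ` crossing_pairs m n \<subseteq> ?C"
    using assms tail_swap_in[of _ m _ n n] by (fastforce simp: crossing_pairs_def)
  show "tail_swap n ` ?C \<subseteq> crossing_pairs m n"
  proof
    fix w assume "w \<in> tail_swap n ` ?C"
    then obtain d c where "w = tail_swap n (d, c)" "d \<in> increasing_lists (n - 1)"
      "c \<in> increasing_lists (Suc m)" by auto
    then show "w \<in> crossing_pairs m n"
      using assms tail_swap_in[of d "n - 1" c "Suc m" n]
        tail_swap_crosses[of d "n - 1" c "Suc m" n]
      by (cases w) (auto simp: crossing_pairs_def)
  qed
qed

section \<open>Interchanges along the diagonals\<close>

lemma nth_row_segment:
  "k < Suc b - a \<Longrightarrow> row_segment s i a b ! k = s (i, a + k)"
  by (simp add: row_segment_def nth_append del: upt_Suc)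

lemma length_row_segment [simp]: "length (row_segment s i a b) = Suc b - a"
  by (simp add: row_segment_def del: upt_Suc)

definition row_pair :: "nat \<Rightarrow> nat \<Rightarrow> (nat \<times> nat \<Rightarrow> 'a) \<Rightarrow> 'a list \<times> 'a list" where
  "row_pair m n t = (row_segment t 1 1 m, row_segment t 2 1 n)"

text \<open>
  The exponent lists of the off-diagonal entries of the determinant.
\<close>

lemma exchange_row_pair:
  assumes "1 \<le> n" "n \<le> m"
  shows "exchange (n - 1) (row_pair m n t) =
    (row_segment t 1 1 (n - 1), row_segment t 2 1 n @ row_segment t 1 n m)"
  using assms unfolding exchange_def row_pair_def
  by (auto intro!: nth_equalityI simp: nth_row_segment nth_append)

text \<open>
  After the exchange at \<open>n - 1\<close> (counting from 0) the second list has \<open>s\<^sub>2\<^sub>,\<^sub>j\<^sub>+\<^sub>1\<close> at place \<open>j\<close>, and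
  the first has \<open>s\<^sub>1\<^sub>j\<close> at place \<open>j - 1\<close>. The exchange at \<open>p\<close> moves the tail of the second list one
  place left into the first row and the tail of the first list one place right into the second
  row, so for \<open>p < j < n\<close> these two variables end up in each other's boxes.
\<close>

lemma exchange_exchange_row_pair:
  assumes "p < n" "n \<le> m"
  shows "exchange p (exchange (n - 1) (row_pair m n t)) = row_pair m n (diag_swap {Suc p..n - 1} t)"
proof -
  let ?t = "diag_swap {Suc p..n - 1} t"
  have "take p (row_segment t 1 1 (n - 1)) @ drop (Suc p) (row_segment t 2 1 n @ row_segment t 1 n m)
      = row_segment ?t 1 1 m"
    using assms
    by (intro nth_equalityI) (auto simp: nth_row_segment nth_append diag_swap_def)
  moreover have
    "take (Suc p) (row_segment t 2 1 n @ row_segment t 1 n m) @ drop p (row_segment t 1 1 (n - 1))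
      = row_segment ?t 2 1 n"
    using assms
    by (intro nth_equalityI) (auto simp: nth_row_segment nth_append diag_swap_def)
  ultimately show ?thesis
    using assms exchange_row_pair[of n m t] by (simp add: exchange_def row_pair_def)
qed

lemma diag_swap_diag_swap:
  assumes "0 \<notin> J" "0 \<notin> K"
  shows "diag_swap K (diag_swap J s) = diag_swap (J - K \<union> (K - J)) s"
proof
  fix c :: "nat \<times> nat"
  obtain i j where c: "c = (i, j)" by fastforce
  show "diag_swap K (diag_swap J s) c = diag_swap (J - K \<union> (K - J)) s c"
    using assms unfolding c by (cases j) (auto simp: diag_swap_def)
qed

text \<open>
  Interchanges compose by symmetric difference, and \<open>J \<mapsto> J \<Delta> K\<close> permutes the index sets.
\<close>

lemma sum_diag_diag_swap:
  assumes "K \<subseteq> {1..n - 1}"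
  shows "sum_diag n (\<lambda>t. F (diag_swap K t)) s = sum_diag n F s"
  unfolding sum_diag_def
proof (rule sum.reindex_bij_witness[where i = "\<lambda>J. J - K \<union> (K - J)" and j = "\<lambda>J. J - K \<union> (K - J)"])
  fix J assume "J \<in> Pow {1..n - 1}"
  then have "0 \<notin> J" "0 \<notin> K" using assms by auto
  then show "F (diag_swap (J - K \<union> (K - J)) s) = F (diag_swap K (diag_swap J s))"
    by (simp add: diag_swap_diag_swap)
qed (use assms in auto)

text \<open>
  For a single \<open>t\<close> the two monomials differ in general: applying the exchange at the crossing \<open>p\<close> to both
  exponents and entries turns the left one into the monomial of \<open>z\<close> for \<open>t\<close> with its diagonals
  beyond \<open>p\<close> interchanged. Only the sum over all interchanges restores equality.
\<close>

lemma sum_diag_pair_monomial_tail_swap: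
  assumes "1 \<le> n" "n \<le> m" and z: "z \<in> crossing_pairs m n"
  shows "sum_diag n (\<lambda>t. pair_monomial (exchange (n - 1) (row_pair m n t)) (tail_swap n z)) s =
    sum_diag n (\<lambda>t. pair_monomial (row_pair m n t) z) s"
proof -
  obtain a b where ab: "z = (a, b)" "length a = m" "length b = n"
    using z by (auto simp: crossing_pairs_def increasing_lists_def)
  define p where "p = crossing n z"
  have p: "p < n" using crossing_le[of n a b] assms by (simp add: p_def ab)
  have "pair_monomial (exchange (n - 1) (row_pair m n t)) (tail_swap n z) =
      pair_monomial (row_pair m n (diag_swap {Suc p..n - 1} t)) z" for t
  proof -
    let ?E = "exchange (n - 1) (row_pair m n t)"
    obtain x y where xy: "?E = (x, y)" by fastforce
    obtain d c where dc: "exchange p z = (d, c)" by fastforce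
    have "length x = length d" "length y = length c"
    proof -
      have "x = row_segment t 1 1 (n - 1)" "y = row_segment t 2 1 n @ row_segment t 1 n m"
        using xy unfolding exchange_row_pair[OF assms(1,2)] by simp_all
      moreover have "d = take p a @ drop (Suc p) b" "c = take (Suc p) b @ drop p a"
        using dc ab by (simp_all add: exchange_def)
      ultimately show "length x = length d" "length y = length c"
        using ab p assms by simp_all
    qed
    then have "pair_monomial ?E (exchange p z) =
        pair_monomial (exchange p ?E) (exchange p (exchange p z))"
      unfolding xy dc by (rule pair_monomial_exchange[symmetric])
    also have "\<dots> = pair_monomial (row_pair m n (diag_swap {Suc p..n - 1} t)) z"
      unfolding exchange_exchange_row_pair[OF p assms(2)] using ab p assms
      by (simp add: exchange_exchange)
    finally show ?thesis by (simp add: tail_swap_def p_def)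
  qed
  then show ?thesis
    by (simp add: sum_diag_diag_swap[where F = "\<lambda>t. pair_monomial (row_pair m n t) z"])
qed

section \<open>Two-rowed tableaux as noncrossing pairs\<close>

lemma diagram_two_rows: "diagram [m, n] = {1} \<times> {1..m} \<union> {2} \<times> {1..n}"
  by (auto simp: diagram_def nth_Cons' numeral_2_eq_2 le_Suc_eq)

lemma prod_diagram_two_rows:
  "(\<Prod>b\<in>diagram [m, n]. g b) = (\<Prod>k<m. g (1, Suc k)) * (\<Prod>k<n. g (2, Suc k))"
proof -
  have "(\<Prod>b\<in>diagram [m, n]. g b) = prod g ({1} \<times> {1..m}) * prod g ({2} \<times> {1..n})"
    unfolding diagram_two_rows by (rule prod.union_disjoint) auto
  moreover have "prod g ({i} \<times> {1..l}) = (\<Prod>k<l. g (i, Suc k))" for i l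
    by (rule prod.reindex_bij_witness[where i = "\<lambda>k. (i, Suc k)" and j = "\<lambda>b. snd b - 1"]) auto
  ultimately show ?thesis by simp
qed

definition tableau_of_rows :: "nat list \<times> nat list \<Rightarrow> nat \<times> nat \<Rightarrow> nat" where
  "tableau_of_rows = (\<lambda>(a, b). restrict
     (\<lambda>(i, j). if i = 1 then a ! (j - 1) else b ! (j - 1)) (diagram [length a, length b]))"

lemma bij_betw_tableau_of_rows:
  assumes "n \<le> m"
  shows "bij_betw tableau_of_rows (noncrossing_pairs m n) (SSYT [m, n])"
proof (rule bij_betw_byWitness[where f' = "row_pair m n"])
  show "\<forall>z\<in>noncrossing_pairs m n. row_pair m n (tableau_of_rows z) = z"
    by (auto simp: noncrossing_pairs_def increasing_lists_def row_pair_def tableau_of_rows_def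
        diagram_two_rows nth_row_segment intro!: nth_equalityI)
  show "\<forall>M\<in>SSYT [m, n]. tableau_of_rows (row_pair m n M) = M"
  proof (intro ballI ext)
    fix M :: "nat \<times> nat \<Rightarrow> nat" and c
    assume M: "M \<in> SSYT [m, n]"
    show "tableau_of_rows (row_pair m n M) c = M c"
    proof (cases "c \<in> diagram [m, n]")
      case True
      then show ?thesis
        by (auto simp: tableau_of_rows_def row_pair_def diagram_two_rows nth_row_segment)
    next
      case False
      then have "M c = undefined"
        using M unfolding SSYT_def fillings_def by (auto dest: PiE_arb)
      with False show ?thesis by (simp add: tableau_of_rows_def row_pair_def)
    qed
  qed
  show "tableau_of_rows ` noncrossing_pairs m n \<subseteq> SSYT [m, n]"
  proof (clarify)
    fix a b assume ab: "(a, b) \<in> noncrossing_pairs m n"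
    then have len: "length a = m" "length b = n" and sorted: "sorted a" "sorted b"
      and pos: "\<And>k. k < m \<Longrightarrow> 1 \<le> a ! k" "\<And>k. k < n \<Longrightarrow> 1 \<le> b ! k"
      and less: "\<And>k. k < n \<Longrightarrow> a ! k < b ! k"
      by (auto simp: noncrossing_pairs_def increasing_lists_def)
    have entry: "tableau_of_rows (a, b) (1, Suc k) = a ! k" if "k < m" for k
      using that by (simp add: tableau_of_rows_def len diagram_two_rows)
    have entry': "tableau_of_rows (a, b) (2, Suc k) = b ! k" if "k < n" for k
      using that by (simp add: tableau_of_rows_def len diagram_two_rows)
    have "tableau_of_rows (a, b) \<in> fillings [m, n] {1..}"
      using pos by (auto simp: fillings_def tableau_of_rows_def len diagram_two_rows)
    moreover have "tableau_of_rows (a, b) (i, j) \<le> tableau_of_rows (a, b) (i, j + 1)"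
      if "(i, j) \<in> diagram [m, n]" "(i, j + 1) \<in> diagram [m, n]" for i j
      using that entry[of "j - 1"] entry[of j] entry'[of "j - 1"] entry'[of j]
        sorted_nth_mono[OF sorted(1), of "j - 1" j] sorted_nth_mono[OF sorted(2), of "j - 1" j] len
      by (auto simp: diagram_two_rows)
    moreover have "tableau_of_rows (a, b) (i, j) < tableau_of_rows (a, b) (i + 1, j)"
      if "(i, j) \<in> diagram [m, n]" "(i + 1, j) \<in> diagram [m, n]" for i j
      using that entry[of "j - 1"] entry'[of "j - 1"] less[of "j - 1"]
      by (auto simp: diagram_two_rows numeral_2_eq_2)
    ultimately show "tableau_of_rows (a, b) \<in> SSYT [m, n]"
      by (simp add: SSYT_def)
  qed
  show "row_pair m n ` SSYT [m, n] \<subseteq> noncrossing_pairs m n"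
  proof (rule image_subsetI)
    fix M assume M: "M \<in> SSYT [m, n]"
    have pos: "1 \<le> M c" if "c \<in> diagram [m, n]" for c
      using M that unfolding SSYT_def fillings_def by (auto dest: PiE_mem)
    have row: "M (i, j) \<le> M (i, Suc j)"
      if "(i, j) \<in> diagram [m, n]" "(i, Suc j) \<in> diagram [m, n]" for i j
      using M that by (auto simp: SSYT_def)
    have col: "M (1, j) < M (2, j)" if "1 \<le> j" "j \<le> n" for j
    proof -
      have "(1, j) \<in> diagram [m, n]" "(1 + 1, j) \<in> diagram [m, n]"
        using that assms by (auto simp: diagram_two_rows)
      then have "M (1, j) < M (1 + 1, j)" using M unfolding SSYT_def by blast
      then show ?thesis by (simp add: numeral_2_eq_2)
    qed
    have "row_segment M i 1 l \<in> increasing_lists l"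
      if "\<And>j. 1 \<le> j \<Longrightarrow> j \<le> l \<Longrightarrow> (i, j) \<in> diagram [m, n]" for i l
      using that pos row
      by (auto simp: increasing_lists_def sorted_iff_nth_Suc nth_row_segment in_set_conv_nth)
    then show "row_pair m n M \<in> noncrossing_pairs m n"
      using col assms
      by (auto simp: noncrossing_pairs_def row_pair_def diagram_two_rows nth_row_segment)
  qed
qed

lemma schur_zeta_two_rows:
  assumes "n \<le> m"
  shows "schur_zeta [m, n] t = infsum (pair_monomial (row_pair m n t)) (noncrossing_pairs m n)"
proof -
  have "schur_zeta [m, n] t = (\<Sum>\<^sub>\<infinity>z\<in>noncrossing_pairs m n.
      \<Prod>b\<in>diagram [m, n]. of_nat (tableau_of_rows z b) powr - t b)"
    unfolding schur_zeta_def
    by (rule infsum_reindex_bij_betw[OF bij_betw_tableau_of_rows[OF assms], symmetric])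
  also have "\<dots> = infsum (pair_monomial (row_pair m n t)) (noncrossing_pairs m n)"
  proof (rule infsum_cong)
    fix z assume "z \<in> noncrossing_pairs m n"
    then obtain a b where ab: "z = (a, b)" "length a = m" "length b = n"
      by (auto simp: noncrossing_pairs_def increasing_lists_def)
    show "(\<Prod>b\<in>diagram [m, n]. of_nat (tableau_of_rows z b) powr - t b) =
        pair_monomial (row_pair m n t) z"
      using ab unfolding prod_diagram_two_rows
      by (auto simp: pair_monomial_def row_pair_def monomial_eq_prod nth_row_segment
          tableau_of_rows_def diagram_two_rows intro!: arg_cong2[where f = "(*)"] prod.cong)
  qed
  finally show ?thesis .
qed

section \<open>The two-row Jacobi-Trudi identity\<close>

lemma convergent_row_segment:
  assumes "\<And>j. a \<le> j \<Longrightarrow> j \<le> b \<Longrightarrow> 1 \<le> Re (t (i, j))"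
    and "a \<le> b \<Longrightarrow> 1 < Re (t (i, b))"
  shows "convergent_exponents (row_segment t i a b)"
  using assms
  by (auto simp: convergent_exponents_def row_segment_def last_map simp del: upt_Suc)

lemma convergent_append:
  assumes "\<forall>s\<in>set ss. 1 \<le> Re s" "convergent_exponents ss'" "ss' \<noteq> []"
  shows "convergent_exponents (ss @ ss')"
  using assms by (auto simp: convergent_exponents_def)

theorem theorem1p3:
  fixes m n :: nat and s :: "nat \<times> nat \<Rightarrow> complex"
  assumes "n \<ge> 1" and "m \<ge> n"
    and "s \<in> W [m, n]"
    and "Re (s (1, m)) > 1" and "Re (s (2, n)) > 1"
    and "n \<ge> 2 \<Longrightarrow> Re (s (1, n - 1)) > 1"
  shows "sum_diag n (\<lambda>t. schur_zeta [m, n] t) s =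
    sum_diag n (\<lambda>t. det (vector
      [vector [zeta_star (row_segment t 1 1 m),
               zeta_star (row_segment t 2 1 n @ row_segment t 1 n m)],
       vector [zeta_star (row_segment t 1 1 (n - 1)),
               zeta_star (row_segment t 2 1 n)]] :: complex ^ 2 ^ 2)) s"
  proof -
  let ?N = "noncrossing_pairs m n" and ?X = "crossing_pairs m n"
  let ?T = "increasing_lists (n - 1) \<times> increasing_lists (Suc m)"
  define P where "P t = pair_monomial (row_pair m n t)" for t :: "nat \<times> nat \<Rightarrow> complex"
  define Q where "Q t = pair_monomial (exchange (n - 1) (row_pair m n t))"
    for t :: "nat \<times> nat \<Rightarrow> complex"
  define E where "E t = zeta_star (row_segment t 1 1 (n - 1)) *
      zeta_star (row_segment t 2 1 n @ row_segment t 1 n m)" for t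
  \<comment> \<open>An interchange changes the last variable of one of the four lists only by
    trading \<open>s\<^sub>2\<^sub>n\<close> for \<open>s\<^sub>1\<^sub>,\<^sub>n\<^sub>-\<^sub>1\<close>, both of real part above 1, so every interchanged tableau still gives convergent series.\<close>
  have swapped: "P (diag_swap J s) summable_on ?X \<and>
      Q (diag_swap J s) summable_on ?T \<and> infsum (Q (diag_swap J s)) ?T = E (diag_swap J s) \<and>
      schur_zeta [m, n] (diag_swap J s) + infsum (P (diag_swap J s)) ?X =
        zeta_star (row_segment (diag_swap J s) 1 1 m) *
        zeta_star (row_segment (diag_swap J s) 2 1 n)"
    if J: "J \<subseteq> {1..n - 1}" for J
  proof -
    define t where "t = diag_swap J s"
    have ge: "1 \<le> Re (s c)" if "c \<in> diagram [m, n]" for c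
      using assms(3) that by (simp add: W_def)
    have ge1: "1 \<le> Re (t (1, j))" if "1 \<le> j" "j \<le> m" for j
      using that J assms(1,2) by (auto simp: t_def diag_swap_def diagram_two_rows intro!: ge)
    have ge2: "1 \<le> Re (t (2, j))" if "1 \<le> j" "j \<le> n" for j
      using that J assms(1,2) by (auto simp: t_def diag_swap_def diagram_two_rows intro!: ge)
    have m: "1 < Re (t (1, m))"
      using assms J by (auto simp: t_def diag_swap_def)
    have n: "1 < Re (t (2, n))"
      using assms J by (auto simp: t_def diag_swap_def)
    have n': "1 < Re (t (1, n - 1))" if "1 \<le> n - 1"
      using assms that J by (auto simp: t_def diag_swap_def)
    have conv: "convergent_exponents (row_segment t 1 1 m)"
      "convergent_exponents (row_segment t 2 1 n)"
      "convergent_exponents (row_segment t 1 1 (n - 1))"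
      "convergent_exponents (row_segment t 1 n m)"
      using ge1 ge2 m n n' assms(1,2) by (auto intro!: convergent_row_segment)
    have "row_segment t 1 n m \<noteq> []"
      using assms(2) by (simp add: row_segment_def)
    then have conv': "convergent_exponents (row_segment t 2 1 n @ row_segment t 1 n m)"
      using conv by (intro convergent_append) (auto simp: convergent_exponents_def)
    have lens: "length (row_segment t 1 1 (n - 1)) = n - 1"
      "length (row_segment t 2 1 n @ row_segment t 1 n m) = Suc m"
      using assms(1,2) by auto
    have Q: "Q t summable_on ?T" "infsum (Q t) ?T = E t"
      using pair_monomial_sums[OF conv(3) conv'] assms(1,2)
      unfolding lens Q_def E_def exchange_row_pair[OF assms(1,2)] by blast+
    have P: "P t summable_on increasing_lists m \<times> increasing_lists n"
      "infsum (P t) (increasing_lists m \<times> increasing_lists n) =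
        zeta_star (row_segment t 1 1 m) * zeta_star (row_segment t 2 1 n)"
      using pair_monomial_sums[OF conv(1,2)] by (auto simp: P_def row_pair_def)
    have split: "increasing_lists m \<times> increasing_lists n = ?N \<union> ?X" and disj: "?N \<inter> ?X = {}"
      by (auto simp: noncrossing_pairs_def crossing_pairs_def not_le)
    have PN: "P t summable_on ?N" and PX: "P t summable_on ?X"
      by (rule summable_on_subset_banach[OF P(1)], use split in auto)+
    have "schur_zeta [m, n] t + infsum (P t) ?X =
        zeta_star (row_segment t 1 1 m) * zeta_star (row_segment t 2 1 n)"
      using P(2) infsum_Un_disjoint[OF PN PX disj] schur_zeta_two_rows[OF assms(2), of t]
      by (simp add: split P_def)
    with Q PX show ?thesis by (simp add: t_def)
  qed
  have "sum_diag n (\<lambda>t. infsum (P t) ?X) s = infsum (\<lambda>z. sum_diag n (\<lambda>t. P t z) s) ?X"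
    unfolding sum_diag_def
    by (rule infsum_finite_sum[symmetric]) (use swapped in auto)
  also have "\<dots> = infsum (\<lambda>z. sum_diag n (\<lambda>t. Q t (tail_swap n z)) s) ?X"
    using assms(1,2) unfolding P_def Q_def
    by (intro infsum_cong sum_diag_pair_monomial_tail_swap[symmetric])
  also have "\<dots> = infsum (\<lambda>w. sum_diag n (\<lambda>t. Q t w) s) ?T"
    by (rule infsum_reindex_bij_betw[OF bij_betw_tail_swap]) (use assms in auto)
  also have "\<dots> = sum_diag n (\<lambda>t. infsum (Q t) ?T) s"
    unfolding sum_diag_def
    by (rule infsum_finite_sum) (use swapped in auto)
  also have "\<dots> = sum_diag n E s"
    unfolding sum_diag_def by (rule sum.cong) (use swapped in auto)
  finally have crossing: "sum_diag n (\<lambda>t. infsum (P t) ?X) s = sum_diag n E s" .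
  have "sum_diag n (\<lambda>t. schur_zeta [m, n] t) s + sum_diag n (\<lambda>t. infsum (P t) ?X) s =
      sum_diag n (\<lambda>t. zeta_star (row_segment t 1 1 m) * zeta_star (row_segment t 2 1 n)) s"
    unfolding sum_diag_def sum.distrib[symmetric]
    by (rule sum.cong) (use swapped in auto)
  then show ?thesis
    unfolding crossing
    by (simp add: det_2 E_def sum_diag_def sum_subtractf algebra_simps)
qed

end
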